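(* Let $\mathfrak{g}$ be a nilpotent Lie algebra over a finite field $\mathbb{F}\neq\mathbb{F}_2$, and let $n$ be a non-negative integer such that $\dim[\mathfrak{g},\mathfrak{g}] > n(n-1)/2$. Then the set $\{x\in\mathfrak{g} : b(x)\ge n\}$ of elements of breadth at least $n$ cannot be covered by $|\mathbb{F}|-1$ proper Lie subalgebras of $\mathfrak{g}$ (i.e. it is not contained in the union of any $|\mathbb{F}|-1$ proper subalgebras).
   Context: For an element $x$ of a Lie algebra $\mathfrak{g}$ over a field, the centralizer is $C_{\mathfrak{g}}(x)=\{y\in\mathfrak{g} : [x,y]=0\}$, and the breadth of $x$ is $b(x)=\dim\mathfrak{g}-\dim C_{\mathfrak{g}}(x)$, i.e. the codimension of $C_{\mathfrak{g}}(x)$ in $\mathfrak{g}$ (a non-negative integer or $\infty$). $\mathfrak{g}'=[\mathfrak{g},\mathfrak{g}]$ denotes the derived subalgebra. *)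

theory Defs
  imports Main "HOL-Library.Extended_Nat"
begin

definition lie_algebra :: "('k::field \<Rightarrow> 'g::ab_group_add \<Rightarrow> 'g) \<Rightarrow> ('g \<Rightarrow> 'g \<Rightarrow> 'g) \<Rightarrow> bool" where
  "lie_algebra sc br \<longleftrightarrow>
     vector_space sc \<and>
     (\<forall>x y z. br (x + y) z = br x z + br y z) \<and>
     (\<forall>x y z. br x (y + z) = br x y + br x z) \<and>
     (\<forall>a x y. br (sc a x) y = sc a (br x y)) \<and>
     (\<forall>a x y. br x (sc a y) = sc a (br x y)) \<and>
     (\<forall>x. br x x = 0) \<and>
     (\<forall>x y z. br x (br y z) + br y (br z x) + br z (br x y) = 0)"

fun lcs :: "('k::field \<Rightarrow> 'g::ab_group_add \<Rightarrow> 'g) \<Rightarrow> ('g \<Rightarrow> 'g \<Rightarrow> 'g) \<Rightarrow> nat \<Rightarrow> 'g set" where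
  "lcs sc br 0 = UNIV"
| "lcs sc br (Suc k) = module.span sc {br x y | x y. y \<in> lcs sc br k}"

definition nilpotent_lie :: "('k::field \<Rightarrow> 'g::ab_group_add \<Rightarrow> 'g) \<Rightarrow> ('g \<Rightarrow> 'g \<Rightarrow> 'g) \<Rightarrow> bool" where
  "nilpotent_lie sc br \<longleftrightarrow> (\<exists>k. lcs sc br k = {0})"

definition derived :: "('k::field \<Rightarrow> 'g::ab_group_add \<Rightarrow> 'g) \<Rightarrow> ('g \<Rightarrow> 'g \<Rightarrow> 'g) \<Rightarrow> 'g set" where
  "derived sc br = module.span sc {br x y | x y. True}"

definition edim :: "('k::field \<Rightarrow> 'g::ab_group_add \<Rightarrow> 'g) \<Rightarrow> 'g set \<Rightarrow> enat" where
  "edim sc V = Sup {enat (card S) | S. finite S \<and> S \<subseteq> V \<and> \<not> module.dependent sc S}"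

text \<open>Codimension of a subspace U (= dimension of the quotient g/U): supremum of sizes of
  finite sets whose images in g/U are distinct and linearly independent.\<close>
definition ecodim :: "('k::field \<Rightarrow> 'g::ab_group_add \<Rightarrow> 'g) \<Rightarrow> 'g set \<Rightarrow> enat" where
  "ecodim sc U = Sup {enat (card S) | S. finite S \<and>
      (\<forall>c. (\<Sum>v\<in>S. sc (c v) v) \<in> U \<longrightarrow> (\<forall>v\<in>S. c v = 0))}"

definition centralizer :: "('g \<Rightarrow> 'g \<Rightarrow> 'g::zero) \<Rightarrow> 'g \<Rightarrow> 'g set" where
  "centralizer br x = {y. br x y = 0}"

definition breadth :: "('k::field \<Rightarrow> 'g::ab_group_add \<Rightarrow> 'g) \<Rightarrow> ('g \<Rightarrow> 'g \<Rightarrow> 'g) \<Rightarrow> 'g \<Rightarrow> enat" where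
  "breadth sc br x = ecodim sc (centralizer br x)"

definition lie_subalgebra :: "('k::field \<Rightarrow> 'g::ab_group_add \<Rightarrow> 'g) \<Rightarrow> ('g \<Rightarrow> 'g \<Rightarrow> 'g) \<Rightarrow> 'g set \<Rightarrow> bool" where
  "lie_subalgebra sc br H \<longleftrightarrow> module.subspace sc H \<and> (\<forall>x\<in>H. \<forall>y\<in>H. br x y \<in> H)"

end

theory Submission
  imports Defs
begin

text \<open>
  The bracket is used as an alternating bilinear map. Let \<open>q\<close> be the order of the field and
  suppose that outside of \<open>q - 1\<close> proper subspaces \<open>H\<^sub>i\<close> all elements have breadth at most \<open>m\<close>; then
  the brackets span a space of dimension at most \<open>m(m+1)/2\<close>, by induction on \<open>m\<close>. Since \<open>q\<close> proper
  subspaces cannot cover the space, there is a noncentral \<open>v\<close> outside all \<open>H\<^sub>i\<close>. Every line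
  \<open>x + Fv\<close> has \<open>q\<close> points and meets each \<open>H\<^sub>i\<close> at most once, hence contains some \<open>x' = x + tv\<close>
  outside all \<open>H\<^sub>i\<close>. Modulo \<open>[v, V]\<close>, which has dimension at most \<open>m\<close>, the spaces \<open>[x, V]\<close> and
  \<open>[x', V]\<close> agree, and if \<open>x\<close> does not centralize \<open>v\<close> then \<open>[x', V]\<close> loses the dimension of
  \<open>[x', v] = [x, v]\<close>. So modulo \<open>[v, V]\<close> the hypothesis holds for \<open>m - 1\<close> with the single proper
  subspace \<open>C(v)\<close>. Quotients are expressed by spans \<open>span (S \<union> B)\<close>, with \<open>S\<close> generating
  the subspace divided out.
\<close>

section \<open>Coverings by subspaces and exchange relative to a subspace\<close>

context vector_space
begin

text \<open>Two points of the line in the same \<open>H\<close> differ by a nonzero multiple of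
  \<open>v\<close>, which would put \<open>v\<close> in \<open>H\<close>; pigeonhole does the rest.
  The strict bound also forces the field to be finite, since an infinite type has
  \<open>card\<close> 0.\<close>

lemma line_avoids_subspaces:
  assumes "finite \<H>" and card: "card \<H> < card (UNIV :: 'a set)"
    and sub: "\<And>H. H \<in> \<H> \<Longrightarrow> subspace H" and v: "v \<notin> \<Union>\<H>"
  obtains t where "x + scale t v \<notin> \<Union>\<H>"
proof -
  have uniq: "s = t" if H: "H \<in> \<H>" "x + scale s v \<in> H" "x + scale t v \<in> H" for H s t
  proof (rule ccontr)
    assume "s \<noteq> t"
    have "(x + scale s v) - (x + scale t v) \<in> H"
      using H sub subspace_diff by blast
    then have "scale (s - t) v \<in> H"
      by (simp add: scale_left_diff_distrib)
    then have "scale (inverse (s - t)) (scale (s - t) v) \<in> H"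
      using H(1) sub subspace_scale by blast
    then show False
      using \<open>s \<noteq> t\<close> v H(1) by auto
  qed
  have "\<exists>t. x + scale t v \<notin> \<Union>\<H>"
  proof (rule ccontr)
    assume "\<not> ?thesis"
    then have "\<forall>t. \<exists>H. H \<in> \<H> \<and> x + scale t v \<in> H" by blast
    then obtain h where h: "\<And>t. h t \<in> \<H>" "\<And>t. x + scale t v \<in> h t" by metis
    have "inj h"
      by (rule injI) (metis h uniq)
    then have "card (UNIV :: 'a set) \<le> card \<H>"
      using card_inj_on_le[of h UNIV \<H>] h(1) \<open>finite \<H>\<close> by blast
    then show False using card by simp
  qed
  then show thesis using that by blast
qed

lemma not_covered_by_proper_subspaces:
  assumes "finite \<H>" and "card \<H> \<le> card (UNIV :: 'a set)"
    and "\<And>H. H \<in> \<H> \<Longrightarrow> subspace H \<and> H \<noteq> UNIV"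
  shows "\<Union>\<H> \<noteq> UNIV"
  using assms
proof (induction \<H> rule: finite_induct)
  case empty
  then show ?case by simp
next
  case (insert K \<H>)
  then have "\<Union>\<H> \<noteq> UNIV" by auto
  then obtain v where v: "v \<notin> \<Union>\<H>" by blast
  show ?case
  proof (cases "v \<in> K")
    case True
    have K: "subspace K" "K \<noteq> UNIV"
      using insert.prems(2) by blast+
    then obtain y where y: "y \<notin> K" by blast
    have "card \<H> < card (UNIV :: 'a set)"
      using insert by simp
    moreover have "\<And>H. H \<in> \<H> \<Longrightarrow> subspace H"
      using insert.prems(2) by blast
    ultimately obtain t where t: "y + scale t v \<notin> \<Union>\<H>"
      using line_avoids_subspaces[OF insert.hyps(1) _ _ v] by blast
    \<comment> \<open>Since \<open>v\<close> lies in \<open>K\<close> and \<open>y\<close> does not,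
      the whole line through \<open>y\<close> in direction \<open>v\<close> misses
      \<open>K\<close>.\<close>
    have "y + scale t v \<notin> K"
    proof
      assume "y + scale t v \<in> K"
      then have "(y + scale t v) - scale t v \<in> K"
        using K(1) True subspace_diff subspace_scale by blast
      then show False using y by simp
    qed
    then show ?thesis using t by blast
  next
    case False
    then show ?thesis using v by blast
  qed
qed

text \<open>Steinitz exchange in the quotient by \<open>span S\<close>: a vector that is nonzero
  there can replace one of the generators.\<close>

lemma span_exchange_relative:
  assumes "finite B" and "w \<in> span (S \<union> B)" and "w \<notin> span S"
  obtains b where "b \<in> B" and "span (S \<union> B) \<subseteq> span (insert w (S \<union> (B - {b})))"
proof -
  have "\<exists>b\<in>B. b \<in> span (insert w (S \<union> (B - {b})))"
    using assms
  proof (induction B rule: finite_induct)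
    case empty
    then show ?case by simp
  next
    case (insert a B)
    show ?case
    proof (cases "w \<in> span (S \<union> B)")
      case True
      then obtain b where b: "b \<in> B" "b \<in> span (insert w (S \<union> (B - {b})))"
        using insert by blast
      then show ?thesis
        using span_mono[of "insert w (S \<union> (B - {b}))" "insert w (S \<union> (insert a B - {b}))"] by blast
    next
      case False
      \<comment> \<open>Here \<open>w\<close> is reached only with the help of \<open>a\<close>, so
        \<open>a\<close> has a nonzero coefficient in \<open>w\<close> and can itself be
        exchanged.\<close>
      then have "a \<in> span (insert w (S \<union> B))"
        using insert.prems(1) in_span_insert[of w a "S \<union> B"] by simp
      then show ?thesis using insert.hyps(2) by auto
    qed
  qed
  then obtain b where b: "b \<in> B" "b \<in> span (insert w (S \<union> (B - {b})))" by blast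
  have "S \<union> B \<subseteq> span (insert w (S \<union> (B - {b})))"
    using b(2) by (auto intro: span_base)
  then show thesis
    using that[OF b(1)] span_minimal subspace_span by blast
qed

end

section \<open>Alternating bilinear maps of bounded rank\<close>

locale alternating_bilinear = vector_space sc
  for sc :: "'k::field \<Rightarrow> 'g::ab_group_add \<Rightarrow> 'g" +
  fixes br :: "'g \<Rightarrow> 'g \<Rightarrow> 'g"
  assumes br_add_left: "br (x + y) z = br x z + br y z"
    and br_add_right: "br x (y + z) = br x y + br x z"
    and br_scale_left: "br (sc a x) y = sc a (br x y)"
    and br_scale_right: "br x (sc a y) = sc a (br x y)"
    and br_self: "br x x = 0"
begin

lemma br_zero_right: "br x 0 = 0"
  using br_add_right[of x 0 0] by simp

lemma br_swap: "br y x = - br x y"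
proof -
  have "br (x + y) (x + y) = br x y + br y x"
    by (simp only: br_add_left br_add_right) (simp add: br_self)
  then show ?thesis
    by (simp add: br_self eq_neg_iff_add_eq_0 add.commute)
qed

lemma br_sum_right: "br x (\<Sum>v\<in>A. f v) = (\<Sum>v\<in>A. br x (f v))"
  by (induction A rule: infinite_finite_induct) (simp_all add: br_zero_right br_add_right)

lemma subspace_centralizer_mod: "subspace {x. br v x \<in> span S}"
  by (rule subspaceI)
    (auto simp: br_zero_right br_add_right br_scale_right span_zero span_add span_scale)

lemma brackets_span_bound:
  assumes "finite \<H>" "card \<H> < card (UNIV :: 'k set)"
    and "\<And>H. H \<in> \<H> \<Longrightarrow> subspace H \<and> H \<noteq> UNIV"
    and "\<And>x. x \<notin> \<Union>\<H> \<Longrightarrow> \<exists>B. finite B \<and> card B \<le> m \<and> range (br x) \<subseteq> span (S \<union> B)"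
  shows "\<exists>B. finite B \<and> card B \<le> m * (m + 1) div 2 \<and> (\<forall>x y. br x y \<in> span (S \<union> B))"
  using assms
proof (induction m arbitrary: S \<H>)
  case (0 S \<H>)
  have central: "br x y \<in> span S" if x: "x \<notin> \<Union>\<H>" for x y
    using "0.prems"(4)[OF x] by (auto dest: subsetD[OF _ rangeI])
  have "br y x \<in> span S" for x y
  proof (rule ccontr)
    assume "br y x \<notin> span S"
    then have "{x. br y x \<in> span S} \<noteq> UNIV" by blast
    \<comment> \<open>The strict bound on \<open>card \<H>\<close> leaves room for one more proper
      subspace.\<close>
    then have "\<Union>(insert {x. br y x \<in> span S} \<H>) \<noteq> UNIV"
      using "0.prems" subspace_centralizer_mod
      by (intro not_covered_by_proper_subspaces) (auto simp: card_insert_if)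
    then obtain u where "u \<notin> \<Union>\<H>" "br y u \<notin> span S" by blast
    then show False
      using central[of u y] br_swap[of y u] span_neg by fastforce
  qed
  then show ?case by (intro exI[of _ "{}"]) simp
next
  case (Suc m S \<H>)
  show ?case
  proof (cases "\<forall>x y. br x y \<in> span S")
    case True
    then show ?thesis by (intro exI[of _ "{}"]) simp
  next
    case False
    then obtain y z where yz: "br y z \<notin> span S" by blast
    then have "{x. br y x \<in> span S} \<noteq> UNIV" by blast
    then have "\<Union>(insert {x. br y x \<in> span S} \<H>) \<noteq> UNIV"
      using Suc.prems subspace_centralizer_mod
      by (intro not_covered_by_proper_subspaces) (auto simp: card_insert_if)
    then obtain v where v: "v \<notin> \<Union>\<H>" "br y v \<notin> span S" by blast
    have vy: "br v y \<notin> span S"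
      using v(2) br_swap[of y v] span_neg by fastforce
    obtain D where D: "finite D" "card D \<le> Suc m" "range (br v) \<subseteq> span (S \<union> D)"
      using Suc.prems(4)[OF v(1)] by blast
    let ?C = "{x. br v x \<in> span S}"
    have drop: "\<exists>B. finite B \<and> card B \<le> m \<and> range (br x) \<subseteq> span ((S \<union> D) \<union> B)"
      if x: "x \<notin> \<Union>{?C}" for x
    proof -
      have "\<And>H. H \<in> \<H> \<Longrightarrow> subspace H"
        using Suc.prems(3) by blast
      then obtain t where t: "x + sc t v \<notin> \<Union>\<H>"
        using line_avoids_subspaces[OF Suc.prems(1,2) _ v(1)] by blast
      obtain B where B: "finite B" "card B \<le> Suc m" "range (br (x + sc t v)) \<subseteq> span (S \<union> B)"
        using Suc.prems(4)[OF t] by blast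
      define w where "w = br v x"
      have w: "w \<notin> span S"
        using x by (simp add: w_def)
      have "br (x + sc t v) v = - w"
        by (simp add: br_add_left br_scale_left br_self w_def br_swap[of x v])
      then have "- w \<in> span (S \<union> B)"
        using B(3) by (metis rangeI subsetD)
      then have wB: "w \<in> span (S \<union> B)"
        using span_neg by fastforce
      obtain b where b: "b \<in> B" "span (S \<union> B) \<subseteq> span (insert w (S \<union> (B - {b})))"
        using span_exchange_relative[OF B(1) wB w] by blast
      \<comment> \<open>The vector \<open>w\<close> lies in \<open>[v, V]\<close>, so it is already
        in \<open>span (S \<union> D)\<close>; trading \<open>b\<close> for it leaves at most
        \<open>m\<close> generators.\<close>
      let ?T = "(S \<union> D) \<union> (B - {b})"
      have D_T: "span (S \<union> D) \<subseteq> span ?T"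
        by (rule span_mono) blast
      then have "w \<in> span ?T"
        using D(3) by (auto simp: w_def)
      then have "insert w (S \<union> (B - {b})) \<subseteq> span ?T"
        by (auto intro: span_base)
      then have B_T: "span (S \<union> B) \<subseteq> span ?T"
        using b(2) span_minimal subspace_span by blast
      have "br x u \<in> span ?T" for u
      proof -
        have "br x u = br (x + sc t v) u - sc t (br v u)"
          by (simp add: br_add_left br_scale_left)
        moreover have "br (x + sc t v) u \<in> span ?T" "br v u \<in> span ?T"
          using B(3) B_T D(3) D_T by blast+
        ultimately show ?thesis by (simp add: span_diff span_scale)
      qed
      then show ?thesis
        using B b(1) by (intro exI[of _ "B - {b}"]) auto
    qed
    have "finite (UNIV :: 'k set)"
      using Suc.prems(2) by (simp add: card_ge_0_finite)
    \<comment> \<open>A finite field has the two elements 0 and 1, so a single subspace is an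
      admissible family for the induction hypothesis.\<close>
    then have "card {?C} < card (UNIV :: 'k set)"
      using card_mono[of UNIV "{0, 1 :: 'k}"] by simp
    moreover have "\<And>H. H \<in> {?C} \<Longrightarrow> subspace H \<and> H \<noteq> UNIV"
      using vy subspace_centralizer_mod by blast
    ultimately obtain E where E: "finite E" "card E \<le> m * (m + 1) div 2"
        "\<forall>x y. br x y \<in> span ((S \<union> D) \<union> E)"
      using Suc.IH[of "{?C}" "S \<union> D"] drop by blast
    have "card (D \<union> E) \<le> Suc m + m * (m + 1) div 2"
      using card_Un_le[of D E] D(2) E(2) by linarith
    also have "\<dots> = Suc m * (Suc m + 1) div 2"
    proof -
      have "Suc m * (Suc m + 1) = m * (m + 1) + Suc m * 2" by simp
      then show ?thesis by (simp only: div_mult_self1)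
    qed
    finally show ?thesis
      using D(1) E(1,3) by (intro exI[of _ "D \<union> E"]) (simp add: Un_assoc)
  qed
qed

text \<open>The breadth is the rank of \<open>br x\<close>, whose kernel is the centralizer. The
  bound \<open>m\<close> yields a largest set \<open>S\<close> independent modulo the centralizer,
  and its image spans the range.\<close>

lemma range_br_spanned_of_breadth_le:
  assumes "breadth sc br x \<le> enat m"
  shows "\<exists>B. finite B \<and> card B \<le> m \<and> range (br x) \<subseteq> span B"
proof -
  define Q where "Q S \<longleftrightarrow> finite S \<and>
    (\<forall>c. (\<Sum>v\<in>S. sc (c v) v) \<in> centralizer br x \<longrightarrow> (\<forall>v\<in>S. c v = 0))" for S
  have bound: "card S \<le> m" if "Q S" for S
  proof -
    have "enat (card S) \<le> breadth sc br x"
      unfolding breadth_def ecodim_def using that by (intro Sup_upper) (auto simp: Q_def)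
    then show ?thesis
      using assms by (meson enat_ord_simps(1) order_trans)
  qed
  have "Q {}" by (simp add: Q_def)
  then obtain S where S: "Q S" and max: "\<And>T. Q T \<Longrightarrow> card T \<le> card S"
    using ex_has_greatest_nat[of Q "{}" card "Suc m"] bound by (meson le_imp_less_Suc)
  have fS: "finite S" using S by (simp add: Q_def)
  have "br x y \<in> span (br x ` S)" for y
  proof (cases "y \<in> S")
    case True
    then show ?thesis by (simp add: span_base)
  next
    case False
    then have "\<not> Q (insert y S)"
      using max[of "insert y S"] fS by auto
    then obtain c where c: "(\<Sum>v\<in>insert y S. sc (c v) v) \<in> centralizer br x"
        "\<exists>v\<in>insert y S. c v \<noteq> 0"
      using fS by (auto simp: Q_def)
    have sum0: "sc (c y) (br x y) + (\<Sum>v\<in>S. sc (c v) (br x v)) = 0"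
      using c(1) fS False
      by (simp add: centralizer_def br_add_right br_sum_right br_scale_right)
    \<comment> \<open>Otherwise the relation would involve \<open>S\<close> alone, against its
      independence modulo the centralizer.\<close>
    have "c y \<noteq> 0"
    proof
      assume "c y = 0"
      then have "(\<Sum>v\<in>S. sc (c v) v) \<in> centralizer br x"
        using c(1) fS False by simp
      then have "\<forall>v\<in>S. c v = 0" using S by (auto simp: Q_def)
      then show False using c(2) \<open>c y = 0\<close> by auto
    qed
    have "sc (c y) (br x y) = - (\<Sum>v\<in>S. sc (c v) (br x v))"
      using sum0 by (simp add: eq_neg_iff_add_eq_0)
    also have "\<dots> \<in> span (br x ` S)"
      by (intro span_neg span_sum span_scale span_base) simp
    finally have "sc (inverse (c y)) (sc (c y) (br x y)) \<in> span (br x ` S)"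
      by (rule span_scale)
    then show ?thesis using \<open>c y \<noteq> 0\<close> by simp
  qed
  moreover have "card (br x ` S) \<le> m"
    using card_image_le[OF fS] bound[OF S] order_trans by blast
  ultimately show ?thesis
    using fS by (intro exI[of _ "br x ` S"]) auto
qed

end

section \<open>From breadth to the dimension of the derived subalgebra\<close>

theorem theorem1p2:
  fixes sc :: "'k::{field,finite} \<Rightarrow> 'g::ab_group_add \<Rightarrow> 'g"
    and br :: "'g \<Rightarrow> 'g \<Rightarrow> 'g"
    and n :: nat
    and H :: "nat \<Rightarrow> 'g set"
  assumes "lie_algebra sc br"
    and "nilpotent_lie sc br"
    and "card (UNIV :: 'k set) \<noteq> 2"
    and "edim sc (derived sc br) > enat (n * (n - 1) div 2)"
    and "\<forall>i < card (UNIV :: 'k set) - 1. lie_subalgebra sc br (H i) \<and> H i \<noteq> UNIV"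
  shows "\<not> ({x. breadth sc br x \<ge> enat n} \<subseteq> (\<Union>i < card (UNIV :: 'k set) - 1. H i))"
proof
  assume cover: "{x. breadth sc br x \<ge> enat n} \<subseteq> (\<Union>i < card (UNIV :: 'k set) - 1. H i)"
  interpret alternating_bilinear sc br
    using assms(1) unfolding lie_algebra_def alternating_bilinear_def alternating_bilinear_axioms_def
    by blast
  define \<H> where "\<H> = H ` {..<card (UNIV :: 'k set) - 1}"
  have fin: "finite \<H>" by (simp add: \<H>_def)
  have "0 < card (UNIV :: 'k set)" by (simp add: card_gt_0_iff)
  moreover have "card \<H> \<le> card (UNIV :: 'k set) - 1"
    unfolding \<H>_def using card_image_le[of "{..<card (UNIV :: 'k set) - 1}" H] by simp
  ultimately have card: "card \<H> < card (UNIV :: 'k set)" by linarith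
  have proper: "subspace K \<and> K \<noteq> UNIV" if "K \<in> \<H>" for K
    using that assms(5) by (auto simp: \<H>_def lie_subalgebra_def)
  have cover': "{x. breadth sc br x \<ge> enat n} \<subseteq> \<Union>\<H>"
    using cover by (simp add: \<H>_def)
  show False
  proof (cases n)
    case 0
    \<comment> \<open>Every breadth is at least 0, so the subalgebras would cover
      everything.\<close>
    then have "\<Union>\<H> = UNIV"
      using cover' by (auto simp: zero_enat_def[symmetric])
    then show False
      using not_covered_by_proper_subspaces[OF fin _ proper] card by simp
  next
    case (Suc m)
    \<comment> \<open>With \<open>n = Suc m\<close>, breadth below \<open>n\<close> means at most
      \<open>m\<close>, and the bound \<open>m * (m + 1) div 2\<close> is
      \<open>n * (n - 1) div 2\<close>. The empty \<open>S\<close> means that nothing is divided out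
      yet.\<close>
    have low: "\<exists>B. finite B \<and> card B \<le> m \<and> range (br x) \<subseteq> span ({} \<union> B)" if "x \<notin> \<Union>\<H>" for x
    proof -
      have "breadth sc br x < enat (Suc m)"
        using that cover' Suc by (metis (mono_tags, lifting) mem_Collect_eq not_le subsetD)
      then have "breadth sc br x \<le> enat m"
        by (cases "breadth sc br x") auto
      then show ?thesis
        using range_br_spanned_of_breadth_le by simp
    qed
    obtain B where B: "finite B" "card B \<le> m * (m + 1) div 2" "\<forall>x y. br x y \<in> span ({} \<union> B)"
      using brackets_span_bound[OF fin card proper low] by auto
    have "derived sc br \<subseteq> span B"
      unfolding derived_def using B(3) by (intro span_minimal) auto
    then have "card T \<le> m * (m + 1) div 2" if "finite T" "T \<subseteq> derived sc br" "independent T" for T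
      using independent_span_bound[OF B(1), of T] that B(2) by force
    then have "edim sc (derived sc br) \<le> enat (m * (m + 1) div 2)"
      unfolding edim_def by (intro Sup_least) auto
    then show False
      using assms(4) Suc by (simp add: mult.commute)
  qed
qed

end
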